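(* Let $n\ge 6$ and let $\Lambda$ be an $n\times n$ linking matrix. Then the total Milnor quotient $\mathcal{M}(\Lambda)$ is a non-trivial group.
   Context: A linking matrix is a symmetric $n\times n$ matrix $\Lambda=(\Lambda_{ij})$ with integer entries and zeros on the main diagonal. Let $e_1,\dots,e_n$ be the standard basis of $\mathbb{Z}^n$ and, for $1\le i,j,k\le n$, put $X^{ijk}=e_i\wedge e_j\wedge e_k\in \mathbb{Z}^n\wedge\mathbb{Z}^n\wedge\mathbb{Z}^n$ (third exterior power). Thus $X^{ijk}=0$ if two of the indices coincide, $X^{ijk}=X^{jki}=X^{kij}=-X^{ikj}=-X^{jik}=-X^{kji}$, and $\{X^{ijk}:1\le i<j<k\le n\}$ is a basis, giving an identification with $\mathbb{Z}^{\binom n3}$. For $1\le j\ne k\le n$ let $v_{jk}=\sum_{i=1}^n \Lambda_{ik}X^{ijk}$, and let $V(\Lambda)\subseteq\mathbb{Z}^{\binom n3}$ be the subgroup generated by all $v_{jk}$, $1\le j\neq k\le n$. The total Milnor quotient associated with $\Lambda$ is the abelian group $\mathcal{M}(\Lambda)=\mathbb{Z}^{\binom n3}/V(\Lambda)$. *)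

theory Defs
  imports "HOL-Algebra.Free_Abelian_Groups" "HOL-Algebra.Generated_Groups"
    "Jordan_Normal_Form.Matrix"
begin

text \<open>Indices run through \<open>{0..<n}\<close>, as is customary for \<^typ>\<open>'a mat\<close>.\<close>

definition linking_matrix :: "nat \<Rightarrow> int mat \<Rightarrow> bool" where
  "linking_matrix n L \<longleftrightarrow>
     L \<in> carrier_mat n n \<and> transpose_mat L = L \<and> (\<forall>i<n. L $$ (i, i) = 0)"

definition increasing_triples :: "nat \<Rightarrow> (nat \<times> nat \<times> nat) set" where
  "increasing_triples n = {(i, j, k). i < j \<and> j < k \<and> k < n}"

text \<open>The third exterior power of \<open>\<int>\<^sup>n\<close>, in coordinates: the free abelian group on the
  increasing triples, where \<open>(i, j, k)\<close> stands for the basis element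
  \<open>e\<^sub>i \<and> e\<^sub>j \<and> e\<^sub>k\<close>.\<close>

definition ext_cube :: "nat \<Rightarrow> (nat \<times> nat \<times> nat \<Rightarrow>\<^sub>0 int) monoid" where
  "ext_cube n = free_Abelian_group (increasing_triples n)"

text \<open>The element \<open>e\<^sub>i \<and> e\<^sub>j \<and> e\<^sub>k\<close> for arbitrary indices: the basis element of the sorted
  triple with the sign of the sorting permutation, or zero if two indices coincide.\<close>

definition X :: "nat \<Rightarrow> nat \<Rightarrow> nat \<Rightarrow> (nat \<times> nat \<times> nat \<Rightarrow>\<^sub>0 int)" where
  "X i j k =
    (if i < j \<and> j < k then frag_of (i, j, k)
     else if j < k \<and> k < i then frag_of (j, k, i)
     else if k < i \<and> i < j then frag_of (k, i, j)
     else if i < k \<and> k < j then - frag_of (i, k, j)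
     else if j < i \<and> i < k then - frag_of (j, i, k)
     else if k < j \<and> j < i then - frag_of (k, j, i)
     else 0)"

lemma X_eq_0: "i = j \<or> j = k \<or> i = k \<Longrightarrow> X i j k = 0"
  by (auto simp: X_def)

lemma X_rotate: "X i j k = X j k i"
  by (auto simp: X_def)

lemma X_swap: "X i k j = - X i j k" "X j i k = - X i j k" "X k j i = - X i j k"
  by (auto simp: X_def)

lemma X_increasing: "i < j \<Longrightarrow> j < k \<Longrightarrow> X i j k = frag_of (i, j, k)"
  by (simp add: X_def)

lemma X_closed: "i < n \<Longrightarrow> j < n \<Longrightarrow> k < n \<Longrightarrow> X i j k \<in> carrier (ext_cube n)"
  by (auto simp: X_def ext_cube_def free_Abelian_group_def increasing_triples_def)

definition milnor_vec :: "nat \<Rightarrow> int mat \<Rightarrow> nat \<Rightarrow> nat \<Rightarrow> (nat \<times> nat \<times> nat \<Rightarrow>\<^sub>0 int)" where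
  "milnor_vec n L j k = (\<Sum>i<n. frag_cmul (L $$ (i, k)) (X i j k))"

definition milnor_subgroup :: "nat \<Rightarrow> int mat \<Rightarrow> (nat \<times> nat \<times> nat \<Rightarrow>\<^sub>0 int) set" where
  "milnor_subgroup n L =
     generate (ext_cube n) {milnor_vec n L j k |j k. j < n \<and> k < n \<and> j \<noteq> k}"

definition total_milnor_quotient ::
    "nat \<Rightarrow> int mat \<Rightarrow> (nat \<times> nat \<times> nat \<Rightarrow>\<^sub>0 int) set monoid" where
  "total_milnor_quotient n L = ext_cube n Mod milnor_subgroup n L"

lemma comm_group_ext_cube: "comm_group (ext_cube n)"
  by (simp add: ext_cube_def abelian_free_Abelian_group)

lemma milnor_vec_closed:
  assumes "j < n" "k < n"
  shows "milnor_vec n L j k \<in> carrier (ext_cube n)"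
proof -
  have "Poly_Mapping.keys (\<Sum>i<n. frag_cmul (L $$ (i, k)) (X i j k))
      \<subseteq> (\<Union>i<n. Poly_Mapping.keys (frag_cmul (L $$ (i, k)) (X i j k)))"
    by (rule keys_sum)
  also have "\<dots> \<subseteq> (\<Union>i<n. Poly_Mapping.keys (X i j k))"
    by (intro UN_mono order_refl keys_cmul)
  also have "\<dots> \<subseteq> increasing_triples n"
    using X_closed[OF _ assms] by (intro UN_least) (simp add: ext_cube_def)
  finally show ?thesis
    by (simp add: milnor_vec_def ext_cube_def)
qed

lemma subgroup_milnor_subgroup: "subgroup (milnor_subgroup n L) (ext_cube n)"
  unfolding milnor_subgroup_def
proof (rule group.generate_is_subgroup)
  show "group (ext_cube n)"
    by (simp add: ext_cube_def)
qed (auto intro: milnor_vec_closed)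

text \<open>As \<^const>\<open>trivial_group\<close> includes being a group, this lemma is needed for
  \<open>\<not> trivial_group (total_milnor_quotient n L)\<close> to mean non-triviality.\<close>

lemma comm_group_total_milnor_quotient: "comm_group (total_milnor_quotient n L)"
  unfolding total_milnor_quotient_def
  by (rule comm_group.abelian_FactGroup[OF comm_group_ext_cube subgroup_milnor_subgroup])

end

theory Submission
  imports Defs "HOL-Library.Z2"
begin

text \<open>
  Everything is reduced modulo 2. A subgroup \<open>V\<close> of the exterior cube is proper as soon as some
  nonzero functional from the exterior cube to \<open>\<int>/2\<close> vanishes on it. Modulo 2 the signs disappear, so
  such a functional is just a function \<open>f\<close> on 3-element sets of indices, and its value on
  \<open>v\<^sub>j\<^sub>k\<close> is \<open>w\<^sub>j\<^sub>k = (\<Sum>i. a\<^sub>i\<^sub>k f{i,j,k})\<close>, where \<open>a\<close> is the linking matrix modulo 2. If \<open>f\<close> is supported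
  on the triples inside a fixed 6-element set \<open>U\<close> of indices, only indices \<open>j, k \<in> U\<close> matter, which
  reduces the problem to six indices.

  On six indices there are 20 unknowns \<open>f{i,j,k}\<close> and 30 equations \<open>w\<^sub>j\<^sub>k = 0\<close>, but 19 of the
  equations imply the rest. Two families of linear relations are responsible:
  \<open>(\<Sum>j. a\<^sub>j\<^sub>k w\<^sub>j\<^sub>k) = 0\<close> for each \<open>k\<close>, and \<open>(\<Sum>k. w\<^sub>j\<^sub>k) = 0\<close> for each \<open>j\<close>; in both, the double sum
  is symmetric in two indices and has zero diagonal. By the first relation, for each \<open>k\<close> four of the
  five equations \<open>w\<^sub>j\<^sub>k = 0\<close> suffice: one may omit any \<open>j\<close> with \<open>a\<^sub>j\<^sub>k \<noteq> 0\<close>, and if there is no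
  such \<open>j\<close>, then \<open>w\<^sub>j\<^sub>k = 0\<close> automatically.

  If \<open>a\<close> is zero off the diagonal, every \<open>f\<close> will do. Otherwise choose \<open>p \<noteq> r\<close> with \<open>a\<^sub>r\<^sub>p \<noteq> 0\<close>, and any
  third index \<open>q\<close>. For the four columns \<open>k\<close> other than \<open>p\<close> and \<open>q\<close> impose four equations each. Once
  these columns vanish, the second relation becomes \<open>w\<^sub>j\<^sub>p + w\<^sub>j\<^sub>q = 0\<close>, so column \<open>q\<close> follows from
  column \<open>p\<close>; moreover \<open>w\<^sub>q\<^sub>p = 0\<close>, because \<open>w\<^sub>q\<^sub>q = 0\<close>. In column \<open>p\<close>, imposing the equations for
  the three \<open>j\<close> other than \<open>p\<close>, \<open>q\<close>, \<open>r\<close> is enough, the one for \<open>r\<close> following from the first relation.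
  The total is \<open>4 * 4 + 3 = 19 < 20\<close>, so a nonzero \<open>f\<close> exists
  (lemma \<open>annihilating_form_on_six\<close>).
\<close>

section \<open>Linear algebra modulo 2\<close>

text \<open>The default rewriting of field operations on bits into Boolean ones hides the linear structure
  that the arguments below are about.\<close>

declare add_bit_eq_xor [simp del] mult_bit_eq_and [simp del]
  minus_bit_def [simp del] uminus_bit_def [simp del] bit_not_zero_iff [simp del]

lemma bit_add_self [simp]: "x + x = (0 :: bit)"
  by (cases x) (simp_all add: add_bit_eq_xor)

text \<open>Over a two-element field, dimension counting is the pigeonhole principle: there are fewer
  sets of violated equations than 0/1 assignments, so two assignments violate the same equations, and
  their difference is a nonzero solution.\<close>

lemma homogeneous_system_nonzero_solution:
  fixes W :: "('x \<Rightarrow> bit) \<Rightarrow> 'e \<Rightarrow> bit"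
  assumes "finite A" "finite E" "card E < card A"
    and diff: "\<And>f g e. W (\<lambda>x. f x - g x) e = W f e - W g e"
  obtains f where "\<And>x. x \<notin> A \<Longrightarrow> f x = 0" "\<exists>x. f x \<noteq> 0" "\<And>e. e \<in> E \<Longrightarrow> W f e = 0"
proof -
  define violated where "violated T = {e \<in> E. W (\<lambda>x. of_bool (x \<in> T)) e \<noteq> 0}" for T
  have "card (violated ` Pow A) \<le> card (Pow E)"
    using assms by (intro card_mono) (auto simp: violated_def)
  also have "\<dots> < card (Pow A)"
    using assms by (simp add: card_Pow)
  finally have "\<not> inj_on violated (Pow A)"
    by (rule pigeonhole)
  then obtain S T where ST: "S \<subseteq> A" "T \<subseteq> A" "violated S = violated T" "S \<noteq> T"
    by (auto simp: inj_on_def)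
  define f :: "'x \<Rightarrow> bit" where "f x = of_bool (x \<in> S) - of_bool (x \<in> T)" for x
  show ?thesis
  proof
    show "f x = 0" if "x \<notin> A" for x
      using that ST by (auto simp: f_def)
    from \<open>S \<noteq> T\<close> obtain x where "(x \<in> S) \<noteq> (x \<in> T)"
      by blast
    then show "\<exists>x. f x \<noteq> 0"
      by (intro exI[of _ x]) (auto simp: f_def)
    show "W f e = 0" if "e \<in> E" for e
    proof -
      have "W (\<lambda>x. of_bool (x \<in> S)) e \<noteq> 0 \<longleftrightarrow> W (\<lambda>x. of_bool (x \<in> T)) e \<noteq> 0"
        using ST(3) that unfolding violated_def by blast
      then have "W (\<lambda>x. of_bool (x \<in> S)) e = W (\<lambda>x. of_bool (x \<in> T)) e"
        by (cases "W (\<lambda>x. of_bool (x \<in> S)) e"; cases "W (\<lambda>x. of_bool (x \<in> T)) e") simp_all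
      then show ?thesis
        unfolding f_def diff by simp
    qed
  qed
qed

text \<open>The terms at \<open>(i, j)\<close> and \<open>(j, i)\<close> cancel in characteristic 2.\<close>

lemma double_sum_symmetric_bit:
  fixes g :: "'a \<Rightarrow> 'a \<Rightarrow> bit"
  assumes "finite U" and "\<And>i j. g i j = g j i" and "\<And>i. g i i = 0"
  shows "(\<Sum>i\<in>U. \<Sum>j\<in>U. g i j) = 0"
  using \<open>finite U\<close>
proof induction
  case (insert x U)
  have "(\<Sum>i\<in>insert x U. \<Sum>j\<in>insert x U. g i j)
      = (\<Sum>j\<in>U. g x j) + (\<Sum>i\<in>U. g i x) + (\<Sum>i\<in>U. \<Sum>j\<in>U. g i j)"
    using insert by (simp add: sum.distrib assms(3) add.assoc)
  also have "(\<Sum>i\<in>U. g i x) = (\<Sum>j\<in>U. g x j)"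
    by (rule sum.cong[OF refl assms(2)])
  finally show ?case
    using insert.IH by (simp only: bit_add_self add_0)
qed simp

section \<open>Alternating 3-forms on six indices\<close>

text \<open>The value \<open>w\<^sub>j\<^sub>k\<close> of the functional \<open>f\<close> on \<open>v\<^sub>j\<^sub>k\<close>. Since signs are invisible modulo 2, an alternating
  3-form can be given as a function of the set of its indices, provided that it vanishes on the
  degenerate sets with fewer than three elements.\<close>

definition milnor_pairing :: "'a set \<Rightarrow> ('a \<Rightarrow> 'a \<Rightarrow> bit) \<Rightarrow> ('a set \<Rightarrow> bit) \<Rightarrow> 'a \<Rightarrow> 'a \<Rightarrow> bit" where
  "milnor_pairing U a f j k = (\<Sum>i\<in>U. a i k * f {i, j, k})"

context
  fixes U :: "'a set" and a :: "'a \<Rightarrow> 'a \<Rightarrow> bit" and f :: "'a set \<Rightarrow> bit"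
  assumes finite_U: "finite U"
    and sym_a: "\<And>i j. a i j = a j i"
    and supp_f: "\<And>S. card S \<noteq> 3 \<Longrightarrow> f S = 0"
begin

lemma degenerate_zero: "f {i, i, k} = 0" "f {i, k, i} = 0" "f {k, i, i} = 0"
  by (rule supp_f; simp add: card_insert_if)+

lemma milnor_pairing_self: "milnor_pairing U a f k k = 0"
  by (simp only: milnor_pairing_def degenerate_zero mult_zero_right sum.neutral_const)

text \<open>This is the first relation: its terms \<open>a\<^sub>j\<^sub>k a\<^sub>i\<^sub>k f{i,j,k}\<close> are symmetric in \<open>i\<close> and \<open>j\<close>.\<close>

lemma weighted_sum_first_index_zero: "(\<Sum>j\<in>U. a j k * milnor_pairing U a f j k) = 0"
proof -
  have "(\<Sum>j\<in>U. a j k * milnor_pairing U a f j k) = (\<Sum>j\<in>U. \<Sum>i\<in>U. a j k * (a i k * f {i, j, k}))"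
    by (simp only: milnor_pairing_def sum_distrib_left)
  also have "\<dots> = 0"
    by (rule double_sum_symmetric_bit[OF finite_U])
      (simp_all only: insert_commute mult.left_commute degenerate_zero mult_zero_right)
  finally show ?thesis .
qed

text \<open>This is the second relation: its terms \<open>a\<^sub>i\<^sub>k f{i,j,k}\<close> are symmetric in \<open>i\<close> and \<open>k\<close> because \<open>a\<close> is.\<close>

lemma sum_second_index_zero: "(\<Sum>k\<in>U. milnor_pairing U a f j k) = 0"
  unfolding milnor_pairing_def
proof (rule double_sum_symmetric_bit[OF finite_U])
  show "a i k * f {i, j, k} = a k i * f {k, j, i}" for i k
    using sym_a[of i k] by (simp add: insert_commute)
qed (simp only: degenerate_zero mult_zero_right)

text \<open>In the relation \<open>weighted_sum_first_index_zero\<close>, all terms except the one for \<open>r\<close> vanish.\<close>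

lemma milnor_pairing_zero_of_others:
  assumes "r \<in> U" "r \<noteq> k" "a r k \<noteq> 0"
    and "\<And>j. j \<in> U - {k, r} \<Longrightarrow> milnor_pairing U a f j k = 0"
  shows "milnor_pairing U a f r k = 0"
proof -
  have "milnor_pairing U a f j k = 0" if "j \<in> U - {r}" for j
    using assms(4)[of j] that milnor_pairing_self by (cases "j = k") auto
  then have "(\<Sum>j\<in>U. a j k * milnor_pairing U a f j k) = a r k * milnor_pairing U a f r k"
    using finite_U \<open>r \<in> U\<close> by (simp add: sum.remove[of U r])
  then show ?thesis
    using weighted_sum_first_index_zero[of k] assms(3) by simp
qed

end

text \<open>There are 20 unknowns, one for each 3-element subset of \<open>U\<close>, and by the two relations it is
  enough to satisfy 19 of the equations; which ones depends on \<open>a\<close>.\<close>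

lemma annihilating_form_on_six:
  fixes a :: "'a \<Rightarrow> 'a \<Rightarrow> bit"
  assumes "card U = 6" and sym_a: "\<And>i j. a i j = a j i"
  obtains f where "\<And>S. \<not> (S \<subseteq> U \<and> card S = 3) \<Longrightarrow> f S = 0" "\<exists>S. f S \<noteq> 0"
    "\<And>j k. j \<in> U \<Longrightarrow> k \<in> U \<Longrightarrow> milnor_pairing U a f j k = 0"
proof -
  define triples where "triples = {S. S \<subseteq> U \<and> card S = 3}"
  have fin: "finite U"
    using assms(1) by (metis card.infinite zero_neq_numeral)
  have card_triples: "card triples = 20"
    using n_subsets[OF fin, of 3] by (simp add: triples_def assms(1) eval_nat_numeral)
  have fin_triples: "finite triples"
    using card_triples by (metis card.infinite zero_neq_numeral)
  \<comment> \<open>The equation omitted in column \<open>k\<close> is the one for \<open>pivot k\<close>: an index with nonzero entry in that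
    column if there is one, and an arbitrary index other than \<open>k\<close> in a zero column.\<close>
  define pivot where "pivot k = (SOME r. r \<in> U - {k} \<and> ((\<exists>r\<in>U-{k}. a r k \<noteq> 0) \<longrightarrow> a r k \<noteq> 0))" for k
  have pivot: "pivot k \<in> U - {k} \<and> ((\<exists>r\<in>U-{k}. a r k \<noteq> 0) \<longrightarrow> a (pivot k) k \<noteq> 0)" for k
    unfolding pivot_def
  proof (rule someI_ex, cases "\<exists>r\<in>U-{k}. a r k \<noteq> 0")
    case False
    have "U - {k} \<noteq> {}"
      using assms(1) card_mono[of "{k}" U] by force
    with False show "\<exists>r. r \<in> U - {k} \<and> ((\<exists>r\<in>U-{k}. a r k \<noteq> 0) \<longrightarrow> a r k \<noteq> 0)"
      by auto
  qed auto
  have card_col: "card (U - {k, pivot k}) = 4" if "k \<in> U" for k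
    using fin pivot[of k] that assms(1) by (subst card_Diff_subset) auto
  have isolated: "milnor_pairing U a f j k = 0"
    if f3: "\<And>S. card S \<noteq> 3 \<Longrightarrow> f S = 0" and iso: "\<forall>r\<in>U-{k}. a r k = 0" for f j k
    unfolding milnor_pairing_def
  proof (intro sum.neutral ballI)
    show "a i k * f {i, j, k} = 0" if "i \<in> U" for i
    proof (cases "i = k")
      case True
      then have "f {i, j, k} = 0"
        using degenerate_zero(2)[OF fin sym_a f3] by (simp only:)
      then show ?thesis
        by (simp only: mult_zero_right)
    next
      case False
      then have "a i k = 0"
        using \<open>i \<in> U\<close> iso by blast
      then show ?thesis
        by (simp only: mult_zero_left)
    qed
  qed
  have column: "milnor_pairing U a f j k = 0"
    if f: "\<And>S. card S \<noteq> 3 \<Longrightarrow> f S = 0" and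
      z: "\<And>j. j \<in> U - {k, pivot k} \<Longrightarrow> milnor_pairing U a f j k = 0" and j: "j \<in> U" for f j k
  proof (cases "\<exists>r\<in>U-{k}. a r k \<noteq> 0")
    case True
    then have pivot_k: "pivot k \<in> U" "pivot k \<noteq> k" "a (pivot k) k \<noteq> 0"
      using pivot[of k] by blast+
    have "milnor_pairing U a f (pivot k) k = 0"
      by (rule milnor_pairing_zero_of_others[OF fin sym_a f pivot_k z])
    moreover have "milnor_pairing U a f k k = 0"
      by (rule milnor_pairing_self[OF fin sym_a f])
    ultimately show ?thesis
      using j z[of j] by blast
  next
    case False
    then show ?thesis
      by (intro isolated f) blast+
  qed
  show ?thesis
  proof (cases "\<exists>p\<in>U. \<exists>r\<in>U-{p}. a r p \<noteq> 0")
    case False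
    define f :: "'a set \<Rightarrow> bit" where "f S = of_bool (S \<in> triples)" for S
    have "triples \<noteq> {}"
      using card_triples by auto
    then show ?thesis
      using False by (intro that[of f]) (auto simp: f_def triples_def intro!: isolated)
  next
    case True
    then obtain p r where p: "p \<in> U" and r: "r \<in> U" "r \<noteq> p" "a r p \<noteq> 0"
      by blast
    have "card (U - {p, r}) = 4"
      using fin p r assms(1) by (simp add: card_Diff_subset)
    then obtain q where q: "q \<in> U" "q \<noteq> p" "q \<noteq> r"
      by (metis Diff_iff card.empty equals0I insertCI zero_neq_numeral)
    \<comment> \<open>A pair \<open>(k, j)\<close> in \<open>E\<close> stands for the equation \<open>w\<^sub>j\<^sub>k = 0\<close>; columns come first to fit the
      dependent sum.\<close>
    define E where "E = (SIGMA k:U-{p,q}. U - {k, pivot k}) \<union> {p} \<times> (U - {p,q,r})"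
    have "card E \<le> card (SIGMA k:U-{p,q}. U - {k, pivot k}) + card ({p} \<times> (U - {p,q,r}))"
      unfolding E_def by (rule card_Un_le)
    also have "card (SIGMA k:U-{p,q}. U - {k, pivot k}) = (\<Sum>k\<in>U-{p,q}. 4)"
      using fin by (simp add: card_SigmaI card_col)
    also have "\<dots> = 16"
      using fin p q assms(1) by (simp add: card_Diff_subset)
    also have "card ({p} \<times> (U - {p,q,r})) = 3"
      using fin p q r assms(1) by (simp add: card_cartesian_product card_Diff_subset)
    finally have card_E: "card E < card triples"
      by (simp add: card_triples)
    have fin_E: "finite E"
      using fin by (auto simp: E_def)
    define W where "W f = (\<lambda>(k, j). milnor_pairing U a f j k)" for f
    have "W (\<lambda>S. f S - g S) e = W f e - W g e" for f g e
      by (simp add: W_def milnor_pairing_def right_diff_distrib sum_subtractf split: prod.split)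
    from homogeneous_system_nonzero_solution[where W = W, OF fin_triples fin_E card_E this]
    obtain f where supp: "\<And>S. S \<notin> triples \<Longrightarrow> f S = 0" and nz: "\<exists>S. f S \<noteq> 0"
      and eqs: "\<And>e. e \<in> E \<Longrightarrow> W f e = 0"
      by blast
    have eq: "milnor_pairing U a f j k = 0" if "(k, j) \<in> E" for j k
      using eqs[OF that] by (simp add: W_def)
    have f3: "f S = 0" if "card S \<noteq> 3" for S
      using that by (intro supp) (auto simp: triples_def)
    have other: "milnor_pairing U a f j k = 0" if "j \<in> U" "k \<in> U - {p, q}" for j k
    proof (rule column[OF f3])
      show "milnor_pairing U a f i k = 0" if "i \<in> U - {k, pivot k}" for i
        using that \<open>k \<in> _\<close> by (intro eq) (auto simp: E_def)
    qed (use that in auto)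
    have self: "milnor_pairing U a f k k = 0" for k
      by (rule milnor_pairing_self[OF fin sym_a f3])
    have pq: "milnor_pairing U a f j p + milnor_pairing U a f j q = 0" if "j \<in> U" for j
    proof -
      have "(\<Sum>k\<in>U. milnor_pairing U a f j k) = (\<Sum>k\<in>{p,q}. milnor_pairing U a f j k)"
        using fin p q other that by (intro sum.mono_neutral_right) auto
      then show ?thesis
        using sum_second_index_zero[OF fin sym_a f3, where j = j] q by simp
    qed
    have qp: "milnor_pairing U a f q p = 0"
      using pq[of q] q self by simp
    have p_others: "milnor_pairing U a f j p = 0" if "j \<in> U - {p, r}" for j
    proof (cases "j = q")
      case False
      then show ?thesis
        using that by (intro eq) (auto simp: E_def)
    qed (simp add: qp)
    have "milnor_pairing U a f r p = 0"
      by (rule milnor_pairing_zero_of_others[OF fin sym_a f3 r p_others])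
    then have colp: "milnor_pairing U a f j p = 0" if "j \<in> U" for j
      using p_others[of j] self that by blast
    then have colq: "milnor_pairing U a f j q = 0" if "j \<in> U" for j
      using pq[OF that] that by simp
    show ?thesis
    proof (rule that[of f])
      show "milnor_pairing U a f j k = 0" if "j \<in> U" "k \<in> U" for j k
        using colp colq other that by blast
    qed (use supp nz in \<open>auto simp: triples_def\<close>)
  qed
qed

section \<open>Functionals on the exterior cube\<close>

definition mod2_functional ::
    "nat \<Rightarrow> (nat set \<Rightarrow> bit) \<Rightarrow> (nat \<times> nat \<times> nat \<Rightarrow>\<^sub>0 int) \<Rightarrow> bit" where
  "mod2_functional n f x =
     (\<Sum>(i, j, k)\<in>increasing_triples n. of_int (Poly_Mapping.lookup x (i, j, k)) * f {i, j, k})"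

lemma finite_increasing_triples: "finite (increasing_triples n)"
  by (rule finite_subset[of _ "{..<n} \<times> {..<n} \<times> {..<n}"]) (auto simp: increasing_triples_def)

lemma mod2_functional_zero [simp]: "mod2_functional n f 0 = 0"
  by (simp add: mod2_functional_def)

lemma mod2_functional_add:
  "mod2_functional n f (x + y) = mod2_functional n f x + mod2_functional n f y"
  unfolding mod2_functional_def sum.distrib[symmetric]
  by (intro sum.cong refl) (auto simp only: lookup_add of_int_add distrib_right split_beta)

lemma mod2_functional_minus: "mod2_functional n f (- x) = mod2_functional n f x"
proof -
  have "mod2_functional n f (- x) + mod2_functional n f x = 0"
    by (simp flip: mod2_functional_add)
  then show ?thesis
    by (cases "mod2_functional n f x"; cases "mod2_functional n f (- x)") simp_all
qed

lemma mod2_functional_sum: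
  "mod2_functional n f (\<Sum>i\<in>I. x i) = (\<Sum>i\<in>I. mod2_functional n f (x i))"
  by (induction I rule: infinite_finite_induct) (simp_all add: mod2_functional_add)

lemma mod2_functional_cmul:
  "mod2_functional n f (frag_cmul c x) = of_int c * mod2_functional n f x"
  unfolding mod2_functional_def sum_distrib_left
  by (intro sum.cong refl) (auto simp: mult.assoc)

lemma mod2_functional_frag_of:
  assumes "i < j" "j < k" "k < n"
  shows "mod2_functional n f (frag_of (i, j, k)) = f {i, j, k}"
proof -
  have "mod2_functional n f (frag_of (i, j, k))
      = (\<Sum>t\<in>increasing_triples n. if t = (i, j, k) then f {i, j, k} else 0)"
    unfolding mod2_functional_def by (intro sum.cong refl) (auto simp: lookup_single when_def split: if_splits)
  also have "\<dots> = f {i, j, k}"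
    using assms by (simp add: finite_increasing_triples) (simp add: increasing_triples_def)
  finally show ?thesis .
qed

text \<open>The sign of the sorting permutation disappears modulo 2, and the vanishing of \<open>f\<close> on degenerate
  sets matches \<open>X i j k = 0\<close> for coinciding indices.\<close>

lemma mod2_functional_X:
  assumes "i < n" "j < n" "k < n" and "\<And>S. card S \<noteq> 3 \<Longrightarrow> f S = 0"
  shows "mod2_functional n f (X i j k) = f {i, j, k}"
proof (cases "i = j \<or> j = k \<or> i = k")
  case True
  then have "f {i, j, k} = 0"
    by (intro assms(4)) (auto simp: card_insert_if)
  with True show ?thesis
    by (simp add: X_eq_0)
next
  case False
  then consider "i < j" "j < k" | "j < k" "k < i" | "k < i" "i < j"
    | "i < k" "k < j" | "j < i" "i < k" | "k < j" "j < i"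
    by linarith
  then show ?thesis
    using assms(1-3)
    by cases (auto simp: X_def mod2_functional_minus mod2_functional_frag_of insert_commute)
qed

lemma mod2_functional_milnor_vec:
  assumes "U \<subseteq> {..<n}" "j < n" "k < n" and f: "\<And>S. \<not> (S \<subseteq> U \<and> card S = 3) \<Longrightarrow> f S = 0"
  shows "mod2_functional n f (milnor_vec n L j k) = milnor_pairing U (\<lambda>i k. of_int (L $$ (i, k))) f j k"
proof -
  have "mod2_functional n f (milnor_vec n L j k) = (\<Sum>i<n. of_int (L $$ (i, k)) * f {i, j, k})"
    unfolding milnor_vec_def mod2_functional_sum mod2_functional_cmul
    using assms(2,3) f by (intro sum.cong refl arg_cong2[where f = times] mod2_functional_X) auto
  also have "\<dots> = (\<Sum>i\<in>U. of_int (L $$ (i, k)) * f {i, j, k})"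
    using assms(1) f by (intro sum.mono_neutral_right) auto
  finally show ?thesis
    by (simp add: milnor_pairing_def)
qed

lemma mod2_functional_zero_on_milnor_subgroup:
  assumes "\<And>j k. j < n \<Longrightarrow> k < n \<Longrightarrow> mod2_functional n f (milnor_vec n L j k) = 0"
    and "x \<in> milnor_subgroup n L"
  shows "mod2_functional n f x = 0"
proof -
  have "milnor_subgroup n L \<subseteq> {x \<in> carrier (ext_cube n). mod2_functional n f x = 0}"
    unfolding milnor_subgroup_def
  proof (rule group.generate_subgroup_incl)
    show grp: "group (ext_cube n)"
      by (simp add: ext_cube_def)
    show "{milnor_vec n L j k |j k. j < n \<and> k < n \<and> j \<noteq> k}
        \<subseteq> {x \<in> carrier (ext_cube n). mod2_functional n f x = 0}"
      using assms(1) milnor_vec_closed by auto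
    show "subgroup {x \<in> carrier (ext_cube n). mod2_functional n f x = 0} (ext_cube n)"
    proof (rule group.subgroupI[OF grp])
      show "{x \<in> carrier (ext_cube n). mod2_functional n f x = 0} \<noteq> {}"
        using mod2_functional_zero[of n f] by (force simp: ext_cube_def)
    next
      fix x
      assume "x \<in> {x \<in> carrier (ext_cube n). mod2_functional n f x = 0}"
      then show "inv\<^bsub>ext_cube n\<^esub> x \<in> {x \<in> carrier (ext_cube n). mod2_functional n f x = 0}"
        by (simp add: ext_cube_def mod2_functional_minus)
    next
      fix x y
      assume "x \<in> {x \<in> carrier (ext_cube n). mod2_functional n f x = 0}"
        and "y \<in> {x \<in> carrier (ext_cube n). mod2_functional n f x = 0}"
      then show "x \<otimes>\<^bsub>ext_cube n\<^esub> y \<in> {x \<in> carrier (ext_cube n). mod2_functional n f x = 0}"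
        using keys_add[of x y] by (auto simp: ext_cube_def mod2_functional_add)
    qed auto
  qed
  then show ?thesis
    using assms(2) by auto
qed

lemma (in group) trivial_FactGroup_imp_carrier_subset:
  assumes "subgroup H G" "trivial_group (G Mod H)"
  shows "carrier G \<subseteq> H"
proof
  fix x
  assume x: "x \<in> carrier G"
  have "H #> x \<in> carrier (G Mod H)"
    using x by (auto simp: FactGroup_def RCOSETS_def)
  then have "H #> x = H"
    using assms(2) by (simp add: trivial_group_def FactGroup_def)
  then show "x \<in> H"
    using rcos_self[OF x assms(1)] by simp
qed

section \<open>Nontriviality of the total Milnor quotient\<close>

theorem theorem1p1:
  fixes n :: nat and L :: "int mat"
  assumes "n \<ge> 6" and "linking_matrix n L"
  shows "\<not> trivial_group (total_milnor_quotient n L)"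
proof
  assume triv: "trivial_group (total_milnor_quotient n L)"
  define a :: "nat \<Rightarrow> nat \<Rightarrow> bit" where "a i k = of_int (L $$ (i, k))" for i k
  \<comment> \<open>Entries outside the matrix dimensions are arbitrary, so symmetry for all indices requires
    cutting them off.\<close>
  define b where "b i k = (if i < n \<and> k < n then a i k else 0)" for i k
  have sym: "b i k = b k i" for i k
  proof (cases "i < n \<and> k < n")
    case True
    then have "transpose_mat L $$ (k, i) = L $$ (i, k)"
      using assms(2) by (intro index_transpose_mat) (auto simp: linking_matrix_def)
    moreover have "transpose_mat L = L"
      using assms(2) by (simp add: linking_matrix_def)
    ultimately show ?thesis
      by (simp add: a_def b_def)
  qed (auto simp: b_def)
  have "card {..<6::nat} = 6"
    by simp
  then obtain f where f: "\<And>S. \<not> (S \<subseteq> {..<6} \<and> card S = 3) \<Longrightarrow> f S = 0"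
    and "\<exists>S. f S \<noteq> 0"
    and ann: "\<And>j k. j \<in> {..<6} \<Longrightarrow> k \<in> {..<6} \<Longrightarrow> milnor_pairing {..<6} b f j k = 0"
    by (rule annihilating_form_on_six[where a = b]) (use sym in auto)
  have "mod2_functional n f (milnor_vec n L j k) = 0" if "j < n" "k < n" for j k
  proof -
    have "mod2_functional n f (milnor_vec n L j k) = milnor_pairing {..<6} a f j k"
      unfolding a_def using assms(1) that f by (intro mod2_functional_milnor_vec) auto
    also have "\<dots> = milnor_pairing {..<6} b f j k"
      unfolding milnor_pairing_def using assms(1) that by (intro sum.cong refl) (auto simp: b_def)
    also have "\<dots> = 0"
      \<comment> \<open>If \<open>j\<close> or \<open>k\<close> lies outside the six indices, so does every triple \<open>{i, j, k}\<close>.\<close>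
    proof (cases "j < 6 \<and> k < 6")
      case False
      then show ?thesis
        unfolding milnor_pairing_def by (intro sum.neutral ballI) (auto simp: f)
    qed (simp add: ann)
    finally show ?thesis .
  qed
  note zero = mod2_functional_zero_on_milnor_subgroup[of n f L, OF this]
  obtain S where "f S \<noteq> 0"
    using \<open>\<exists>S. f S \<noteq> 0\<close> by blast
  with f have "S \<subseteq> {..<6}" "card S = 3"
    by blast+
  then obtain i j k where "S = {i, j, k}"
    by (auto simp: card_3_iff)
  with \<open>S \<subseteq> {..<6}\<close> assms(1) have less: "i < n" "j < n" "k < n"
    by auto
  have "carrier (ext_cube n) \<subseteq> milnor_subgroup n L"
    using triv unfolding total_milnor_quotient_def
    by (intro group.trivial_FactGroup_imp_carrier_subset subgroup_milnor_subgroup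
          comm_group.axioms(2)[OF comm_group_ext_cube])
  then have "mod2_functional n f (X i j k) = 0"
    using X_closed[OF less] by (intro zero) auto
  moreover have "mod2_functional n f (X i j k) = f S"
    unfolding \<open>S = _\<close> by (intro mod2_functional_X less f) auto
  ultimately show False
    using \<open>f S \<noteq> 0\<close> by simp
qed

end
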